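(* Let $\mathbb{F}$ be a field with $\mathrm{char}(\mathbb{F})\neq2,3$. Suppose that $E=\langle e,f\rangle$ is a $2$-dimensional vector space over $\mathbb{F}$ with a symmetric bilinear form $b$ such that $b(e,e)=b(f,f)=1$ and $b(e,f)=\mu$. Then $\widehat{S}(b,-1)^\circ\cong\mathrm{III}(-1,\frac12,-2\mu-1)$, provided that $\mu\neq1$.
   Context: $\widehat{S}(b,-1)^\circ$ is the commutative (not necessarily associative) algebra on the vector space $E\oplus\mathbb{F}z_1\oplus\mathbb{F}n$ with multiplication $z_1^2=z_1$, $n^2=0$, $z_1n=0$, $ez_1=-e$, $en=0$, $ef=-b(e,f)z$ for all $e,f\in E$, where $z:=3z_1-2n$. For $\alpha,\delta\in\mathbb{F}$, Yabe's algebra $\mathrm{III}(\alpha,\frac12,\delta)$ is the $4$-dimensional commutative algebra over $\mathbb{F}$ with basis $a_{-1},a_0,a_1,q$ and multiplication, writing $s:=\frac{2\alpha-1}{4}\left(a_1+a_{-1}+(\delta+1)a_0\right)+q$: $a_i^2=a_i$ for $i\in\{-1,0,1\}$; $a_0a_1=\frac12(a_0+a_1)+s$; $a_0a_{-1}=\frac12(a_0+a_{-1})+s$; $a_1a_{-1}=\frac12(a_1+a_{-1})+(1-\delta)s$; $q\,a_i=-\frac{\alpha(\alpha+1)(\delta+3)}{8}\,a_i$ for $i\in\{-1,0,1\}$; $q^2=-\frac{\alpha(\alpha+1)(\delta+3)}{8}\,q$. Here it is taken with $\alpha=-1$ (so $q$ annihilates the whole algebra). *)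

theory Defs
  imports "HOL-Analysis.Analysis"
begin

section \<open>Algebras, isomorphism and bilinear forms over an arbitrary field\<close>

text \<open>
  A (not necessarily associative) algebra is given by an additive group, a scalar multiplication
  and a multiplication, each of them on a whole type.
\<close>

definition bilinear_mult ::
    "('k::field \<Rightarrow> 'v::ab_group_add \<Rightarrow> 'v) \<Rightarrow> ('v \<Rightarrow> 'v \<Rightarrow> 'v) \<Rightarrow> bool" where
  "bilinear_mult smul m \<longleftrightarrow>
     (\<forall>x. Vector_Spaces.linear smul smul (m x)) \<and>
     (\<forall>y. Vector_Spaces.linear smul smul (\<lambda>x. m x y))"

definition algebra_isomorphic ::
    "('k::field \<Rightarrow> 'v::ab_group_add \<Rightarrow> 'v) \<Rightarrow> ('v \<Rightarrow> 'v \<Rightarrow> 'v) \<Rightarrow>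
     ('k \<Rightarrow> 'w::ab_group_add \<Rightarrow> 'w) \<Rightarrow> ('w \<Rightarrow> 'w \<Rightarrow> 'w) \<Rightarrow> bool" where
  "algebra_isomorphic smul1 m1 smul2 m2 \<longleftrightarrow>
     (\<exists>\<phi>. Vector_Spaces.linear smul1 smul2 \<phi> \<and> bij \<phi> \<and>
          (\<forall>x y. \<phi> (m1 x y) = m2 (\<phi> x) (\<phi> y)))"

definition symmetric_bilinear_form ::
    "('k::field \<Rightarrow> 'v::ab_group_add \<Rightarrow> 'v) \<Rightarrow> ('v \<Rightarrow> 'v \<Rightarrow> 'k) \<Rightarrow> bool" where
  "symmetric_bilinear_form smul b \<longleftrightarrow>
     (\<forall>x. Vector_Spaces.linear smul (*) (b x)) \<and>
     (\<forall>y. Vector_Spaces.linear smul (*) (\<lambda>x. b x y)) \<and>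
     (\<forall>x y. b x y = b y x)"

section \<open>The algebra written S-hat(b,-1) with a circle superscript\<close>

text \<open>
  The triple \<open>(x, s, t)\<close> stands for \<open>x + s z\<^sub>1 + t n\<close>, an element of the direct sum of \<open>E\<close> and the
  lines spanned by \<open>z\<^sub>1\<close> and \<open>n\<close>.
\<close>

definition Shat_scale ::
    "('k::field \<Rightarrow> 'e::ab_group_add \<Rightarrow> 'e) \<Rightarrow> 'k \<Rightarrow> 'e \<times> 'k \<times> 'k \<Rightarrow> 'e \<times> 'k \<times> 'k" where
  "Shat_scale smul c = (\<lambda>(x, s, t). (smul c x, c * s, c * t))"

definition Shat_E :: "'e \<Rightarrow> 'e::ab_group_add \<times> 'k::field \<times> 'k" where
  "Shat_E x = (x, 0, 0)"

definition Shat_z1 :: "'e::ab_group_add \<times> 'k::field \<times> 'k" where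
  "Shat_z1 = (0, 1, 0)"

definition Shat_n :: "'e::ab_group_add \<times> 'k::field \<times> 'k" where
  "Shat_n = (0, 0, 1)"

definition Shat_z ::
    "('k::field \<Rightarrow> 'e::ab_group_add \<Rightarrow> 'e) \<Rightarrow> 'e \<times> 'k \<times> 'k" where
  "Shat_z smul = Shat_scale smul 3 Shat_z1 - Shat_scale smul 2 Shat_n"

text \<open>
  The bilinear extension of the multiplication rules for \<open>E\<close>, \<open>z\<^sub>1\<close> and \<open>n\<close>, which are recovered
  in \<open>Shat_mult_rules\<close> below: the \<open>E\<close>-component collects \<open>x z\<^sub>1 = -x\<close>, the product
  \<open>z\<^sub>1 z\<^sub>1 = z\<^sub>1\<close> contributes \<open>s s'\<close> to the second component, and \<open>x x' = -b(x,x') z\<close> contributes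
  \<open>-3 b(x,x')\<close> and \<open>2 b(x,x')\<close> to the last two. All products with \<open>n\<close> vanish.
\<close>

definition Shat_mult ::
    "('k::field \<Rightarrow> 'e::ab_group_add \<Rightarrow> 'e) \<Rightarrow> ('e \<Rightarrow> 'e \<Rightarrow> 'k) \<Rightarrow>
     'e \<times> 'k \<times> 'k \<Rightarrow> 'e \<times> 'k \<times> 'k \<Rightarrow> 'e \<times> 'k \<times> 'k" where
  "Shat_mult smul b = (\<lambda>(x, s, t) (x', s', t').
     (- smul s' x - smul s x', s * s' - 3 * b x x', 2 * b x x'))"

lemma symmetric_bilinear_formD:
  assumes "symmetric_bilinear_form smul b"
  shows "b (x + x') y = b x y + b x' y" "b x (y + y') = b x y + b x y'"
    "b (smul c x) y = c * b x y" "b x (smul c y) = c * b x y" "b x 0 = 0" "b 0 y = 0"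
    "b x y = b y x"
proof -
  have l: "Vector_Spaces.linear smul (*) (b x)" "Vector_Spaces.linear smul (*) (\<lambda>x. b x y)"
    for x y using assms unfolding symmetric_bilinear_form_def by blast+
  interpret L: Vector_Spaces.linear smul "(*)" "b x" by (rule l)
  interpret R: Vector_Spaces.linear smul "(*)" "\<lambda>x. b x y" by (rule l)
  show "b (x + x') y = b x y + b x' y" "b x (y + y') = b x y + b x y'"
    "b (smul c x) y = c * b x y" "b x (smul c y) = c * b x y" "b x 0 = 0" "b 0 y = 0"
    by (rule R.add L.add R.scale L.scale L.zero R.zero)+
  show "b x y = b y x" using assms unfolding symmetric_bilinear_form_def by blast
qed

lemma Shat_mult_rules:
  assumes "vector_space smul" and "symmetric_bilinear_form smul b"
  shows "Shat_mult smul b Shat_z1 Shat_z1 = Shat_z1"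
    and "Shat_mult smul b Shat_n Shat_n = 0"
    and "Shat_mult smul b Shat_z1 Shat_n = 0"
    and "Shat_mult smul b (Shat_E x) Shat_z1 = - Shat_E x"
    and "Shat_mult smul b (Shat_E x) Shat_n = 0"
    and "Shat_mult smul b (Shat_E x) (Shat_E y) = Shat_scale smul (- b x y) (Shat_z smul)"
proof -
  interpret vector_space smul by (rule assms(1))
  note [simp] = symmetric_bilinear_formD(5,6)[OF assms(2)]
  show "Shat_mult smul b Shat_z1 Shat_z1 = Shat_z1"
    "Shat_mult smul b Shat_n Shat_n = 0"
    "Shat_mult smul b Shat_z1 Shat_n = 0"
    "Shat_mult smul b (Shat_E x) Shat_z1 = - Shat_E x"
    "Shat_mult smul b (Shat_E x) Shat_n = 0"
    "Shat_mult smul b (Shat_E x) (Shat_E y) = Shat_scale smul (- b x y) (Shat_z smul)"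
    by (simp_all add: Shat_mult_def Shat_z1_def Shat_n_def Shat_E_def Shat_z_def Shat_scale_def
        zero_prod_def)
qed

lemma Shat_mult_commute:
  assumes "symmetric_bilinear_form smul b"
  shows "Shat_mult smul b u v = Shat_mult smul b v u"
  using symmetric_bilinear_formD(7)[OF assms, of "fst u" "fst v"]
  by (auto simp: Shat_mult_def split: prod.splits)

lemma vector_space_Shat_scale:
  assumes "vector_space smul"
  shows "vector_space (Shat_scale smul)"
proof -
  interpret vector_space smul by (rule assms)
  show ?thesis
    by unfold_locales (auto simp: Shat_scale_def algebra_simps split: prod.splits)
qed

lemma bilinear_Shat_mult:
  assumes "vector_space smul" and "symmetric_bilinear_form smul b"
  shows "bilinear_mult (Shat_scale smul) (Shat_mult smul b)"
proof -
  interpret vector_space smul by (rule assms(1))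
  interpret S: vector_space "Shat_scale smul" by (rule vector_space_Shat_scale[OF assms(1)])
  note b = symmetric_bilinear_formD(1-4)[OF assms(2)]
  have R: "Vector_Spaces.linear (Shat_scale smul) (Shat_scale smul) (Shat_mult smul b u)" for u
    by unfold_locales
      (simp_all add: Shat_scale_def Shat_mult_def b case_prod_unfold prod_eq_iff algebra_simps)
  moreover have "(\<lambda>u. Shat_mult smul b u v) = Shat_mult smul b v" for v
    by (rule ext) (rule Shat_mult_commute[OF assms(2)])
  ultimately show ?thesis
    unfolding bilinear_mult_def by simp
qed

section \<open>Yabe's algebra \<open>III(\<alpha>, 1/2, \<delta>)\<close>\<close>

datatype yabe_index = Am1 | A0 | A1 | Q

lemma UNIV_yabe_index: "(UNIV :: yabe_index set) = {Am1, A0, A1, Q}"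
  by (auto intro: yabe_index.exhaust)

instance yabe_index :: finite
  by standard (simp add: UNIV_yabe_index)

text \<open>
  The underlying space consists of the coordinate vectors indexed by \<^typ>\<open>yabe_index\<close>; the basis is
  \<open>a\<^sub>-\<^sub>1 = yabe_basis Am1\<close>, \<open>a\<^sub>0 = yabe_basis A0\<close>, \<open>a\<^sub>1 = yabe_basis A1\<close>, \<open>q = yabe_basis Q\<close>.
\<close>

abbreviation yabe_basis :: "yabe_index \<Rightarrow> 'k::field ^ yabe_index" where
  "yabe_basis i \<equiv> axis i 1"

definition yabe_s :: "'k::field \<Rightarrow> 'k \<Rightarrow> 'k ^ yabe_index" where
  "yabe_s \<alpha> \<delta> =
     ((2 * \<alpha> - 1) / 4) *s (yabe_basis A1 + yabe_basis Am1 + (\<delta> + 1) *s yabe_basis A0)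
       + yabe_basis Q"

definition yabe_q_eigenvalue :: "'k::field \<Rightarrow> 'k \<Rightarrow> 'k" where
  "yabe_q_eigenvalue \<alpha> \<delta> = - (\<alpha> * (\<alpha> + 1) * (\<delta> + 3) / 8)"

fun yabe_basis_mult :: "'k::field \<Rightarrow> 'k \<Rightarrow> yabe_index \<Rightarrow> yabe_index \<Rightarrow> 'k ^ yabe_index" where
  "yabe_basis_mult \<alpha> \<delta> A0 A0 = yabe_basis A0"
| "yabe_basis_mult \<alpha> \<delta> A1 A1 = yabe_basis A1"
| "yabe_basis_mult \<alpha> \<delta> Am1 Am1 = yabe_basis Am1"
| "yabe_basis_mult \<alpha> \<delta> A0 A1 = (1 / 2) *s (yabe_basis A0 + yabe_basis A1) + yabe_s \<alpha> \<delta>"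
| "yabe_basis_mult \<alpha> \<delta> A1 A0 = (1 / 2) *s (yabe_basis A0 + yabe_basis A1) + yabe_s \<alpha> \<delta>"
| "yabe_basis_mult \<alpha> \<delta> A0 Am1 = (1 / 2) *s (yabe_basis A0 + yabe_basis Am1) + yabe_s \<alpha> \<delta>"
| "yabe_basis_mult \<alpha> \<delta> Am1 A0 = (1 / 2) *s (yabe_basis A0 + yabe_basis Am1) + yabe_s \<alpha> \<delta>"
| "yabe_basis_mult \<alpha> \<delta> A1 Am1 =
     (1 / 2) *s (yabe_basis A1 + yabe_basis Am1) + (1 - \<delta>) *s yabe_s \<alpha> \<delta>"
| "yabe_basis_mult \<alpha> \<delta> Am1 A1 =
     (1 / 2) *s (yabe_basis A1 + yabe_basis Am1) + (1 - \<delta>) *s yabe_s \<alpha> \<delta>"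
| "yabe_basis_mult \<alpha> \<delta> Q j = yabe_q_eigenvalue \<alpha> \<delta> *s yabe_basis j"
| "yabe_basis_mult \<alpha> \<delta> i Q = yabe_q_eigenvalue \<alpha> \<delta> *s yabe_basis i"

definition yabe_III_half_mult ::
    "'k::field \<Rightarrow> 'k \<Rightarrow> 'k ^ yabe_index \<Rightarrow> 'k ^ yabe_index \<Rightarrow> 'k ^ yabe_index" where
  "yabe_III_half_mult \<alpha> \<delta> u v =
     (\<Sum>i\<in>UNIV. \<Sum>j\<in>UNIV. (u $ i * v $ j) *s yabe_basis_mult \<alpha> \<delta> i j)"

lemma yabe_III_half_mult_basis:
  "yabe_III_half_mult \<alpha> \<delta> (yabe_basis i) (yabe_basis j) = yabe_basis_mult \<alpha> \<delta> i j"
  by (cases i; cases j) (simp_all add: yabe_III_half_mult_def UNIV_yabe_index axis_def)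

lemma yabe_basis_mult_commute: "yabe_basis_mult \<alpha> \<delta> i j = yabe_basis_mult \<alpha> \<delta> j i"
  by (cases i; cases j) simp_all

lemma yabe_III_half_mult_commute: "yabe_III_half_mult \<alpha> \<delta> u v = yabe_III_half_mult \<alpha> \<delta> v u"
  unfolding yabe_III_half_mult_def
  by (subst sum.swap) (simp add: mult.commute yabe_basis_mult_commute)

lemma bilinear_yabe_III_half_mult: "bilinear_mult (*s) (yabe_III_half_mult \<alpha> \<delta>)"
proof -
  have "Vector_Spaces.linear (*s) (*s) (yabe_III_half_mult \<alpha> \<delta> u)" for u
    by unfold_locales
      (simp_all add: yabe_III_half_mult_def vec.scale_sum_right algebra_simps sum.distrib)
  moreover have "(\<lambda>u. yabe_III_half_mult \<alpha> \<delta> u v) = yabe_III_half_mult \<alpha> \<delta> v" for v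
    by (rule ext) (rule yabe_III_half_mult_commute)
  ultimately show ?thesis
    unfolding bilinear_mult_def by simp
qed

end

theory Submission
  imports Defs
begin

text \<open>
  In the algebra \<open>S\<close> on \<open>E \<oplus> F z\<^sub>1 \<oplus> F n\<close>, the vectors \<open>a\<^sub>x = (x - z\<^sub>1 + n)/2\<close> with \<open>x \<in> E\<close> multiply
  as \<open>a\<^sub>x a\<^sub>y = (a\<^sub>x + a\<^sub>y)/2 + (1 - b(x,y))/4 z\<close> (lemma \<open>Shat_axis_mult\<close>). In particular \<open>a\<^sub>x\<close> is
  idempotent when \<open>b(x,x) = 1\<close>. This is the shape of the products in Yabe's algebra, and it remains
  to choose three vectors with \<open>b(x,x) = 1\<close> that yield the prescribed multiples of \<open>s\<close>:
  take \<open>e\<close> for \<open>a\<^sub>0\<close>, \<open>f\<close> for \<open>a\<^sub>1\<close>, and for \<open>a\<^sub>-\<^sub>1\<close> the reflection \<open>g = 2\<mu>e - f\<close> of \<open>f\<close> in the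
  line of \<open>e\<close>.
  Then \<open>b(g,g) = 1\<close>, \<open>b(e,g) = \<mu>\<close> and \<open>b(f,g) = 2\<mu>\<^sup>2 - 1\<close>, so that \<open>1 - b(f,g) = (1 - \<delta>)(1 - \<mu>)\<close> with
  \<open>\<delta> = -2\<mu> - 1\<close>, and \<open>s\<close> has to correspond to \<open>(1 - \<mu>)/4 z\<close>. Since
  \<open>a\<^sub>f + a\<^sub>g - 2\<mu> a\<^sub>e = (1 - \<mu>)(n - z\<^sub>1)\<close>, the definition of \<open>s\<close> at \<open>\<alpha> = -1\<close> then forces
  \<open>q\<close> to correspond to \<open>(1 - \<mu>)/4 n\<close>, which annihilates \<open>S\<close> as it should.

  The linear map from Yabe's algebra to \<open>S\<close> with these values on the basis is therefore
  multiplicative. For \<open>\<mu> \<noteq> 1\<close> the values form a basis of \<open>S\<close>, because \<open>e, f\<close> form a basis of \<open>E\<close>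
  and the vectors \<open>(1 - \<mu>)(n - z\<^sub>1)\<close> and \<open>(1 - \<mu>)/4 n\<close> span \<open>F z\<^sub>1 \<oplus> F n\<close>. The
  inverse of this map is the required isomorphism.
\<close>

section \<open>Linear maps given on a basis\<close>

lemma algebra_isomorphic_sym:
  assumes "algebra_isomorphic smul1 m1 smul2 m2"
  shows "algebra_isomorphic smul2 m2 smul1 m1"
proof -
  obtain \<phi> where lin: "Vector_Spaces.linear smul1 smul2 \<phi>" and bij: "bij \<phi>"
    and mult: "\<And>x y. \<phi> (m1 x y) = m2 (\<phi> x) (\<phi> y)"
    using assms unfolding algebra_isomorphic_def by blast
  interpret Vector_Spaces.linear smul1 smul2 \<phi> by (rule lin)
  note surj [simp] = surj_f_inv_f[OF bij_is_surj[OF bij]]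
  note eqI = injD[OF bij_is_inj[OF bij]]
  have "Vector_Spaces.linear smul2 smul1 (inv \<phi>)"
    by unfold_locales (rule eqI, simp add: add scale)+
  moreover have "inv \<phi> (m2 x y) = m1 (inv \<phi> x) (inv \<phi> y)" for x y
    by (rule eqI) (simp add: mult)
  ultimately show ?thesis
    unfolding algebra_isomorphic_def using bij_imp_bij_inv[OF bij] by blast
qed

lemma bilinear_mult_sum_scale:
  assumes "bilinear_mult smul m"
  shows "m (\<Sum>i\<in>I. smul (c i) (A i)) (\<Sum>j\<in>J. smul (d j) (B j)) =
    (\<Sum>i\<in>I. \<Sum>j\<in>J. smul (c i * d j) (m (A i) (B j)))"
proof -
  have lin: "Vector_Spaces.linear smul smul (m x)" "Vector_Spaces.linear smul smul (\<lambda>x. m x y)"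
    for x y using assms unfolding bilinear_mult_def by blast+
  interpret vector_space smul
    using lin(1) by (simp add: Vector_Spaces.linear_iff)
  interpret L: Vector_Spaces.linear smul smul "m x" for x by (rule lin)
  interpret R: Vector_Spaces.linear smul smul "\<lambda>x. m x y" for y by (rule lin)
  show ?thesis
    by (simp add: L.sum R.sum L.scale R.scale scale_sum_right)
      (subst sum.swap, simp add: mult.commute)
qed

text \<open>The linear extension of a map \<open>A\<close> given on the coordinate basis.\<close>

definition basis_extension ::
    "('k::field \<Rightarrow> 'v::ab_group_add \<Rightarrow> 'v) \<Rightarrow> ('i::finite \<Rightarrow> 'v) \<Rightarrow> 'k ^ 'i \<Rightarrow> 'v" where
  "basis_extension smul A u = (\<Sum>i\<in>UNIV. smul (u $ i) (A i))"

lemma linear_basis_extension: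
  assumes "vector_space smul"
  shows "Vector_Spaces.linear (*s) smul (basis_extension smul A)"
proof -
  interpret vector_space smul by (rule assms)
  show ?thesis
    by unfold_locales
      (simp_all add: basis_extension_def scale_left_distrib sum.distrib scale_sum_right)
qed

lemma basis_extension_axis:
  assumes "vector_space smul"
  shows "basis_extension smul A (axis i 1) = A i"
proof -
  interpret vector_space smul by (rule assms)
  have "smul (axis i 1 $ j) (A j) = (if i = j then A j else 0)" for j
    by (simp add: axis_def)
  then show ?thesis
    by (simp add: basis_extension_def)
qed

lemma basis_extension_yabe_mult:
  assumes "bilinear_mult smul m" and "vector_space smul"
    and basis: "\<And>i j. basis_extension smul A (yabe_basis_mult \<alpha> \<delta> i j) = m (A i) (A j)"
  shows "basis_extension smul A (yabe_III_half_mult \<alpha> \<delta> u v) =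
    m (basis_extension smul A u) (basis_extension smul A v)"
proof -
  interpret Vector_Spaces.linear "(*s)" smul "basis_extension smul A"
    by (rule linear_basis_extension[OF assms(2)])
  have "basis_extension smul A (yabe_III_half_mult \<alpha> \<delta> u v) =
      (\<Sum>i\<in>UNIV. \<Sum>j\<in>UNIV. smul (u $ i * v $ j) (m (A i) (A j)))"
    by (simp only: yabe_III_half_mult_def sum scale basis)
  also have "\<dots> = m (basis_extension smul A u) (basis_extension smul A v)"
    by (simp only: basis_extension_def bilinear_mult_sum_scale[OF assms(1)])
  finally show ?thesis .
qed

section \<open>Idempotents attached to vectors of the quadratic space\<close>

text \<open>The vector \<open>a\<^sub>x = (x - z\<^sub>1 + n)/2\<close>; it is an idempotent when \<open>b(x,x) = 1\<close>.\<close>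

definition Shat_axis ::
    "('k::field \<Rightarrow> 'e::ab_group_add \<Rightarrow> 'e) \<Rightarrow> 'e \<Rightarrow> 'e \<times> 'k \<times> 'k" where
  "Shat_axis smul x = Shat_scale smul (1 / 2) (Shat_E x - Shat_z1 + Shat_n)"

lemma Shat_axis_eq:
  "Shat_axis smul x = (smul (1 / 2) x, - (1 / 2), 1 / 2)"
  by (simp add: Shat_axis_def Shat_scale_def Shat_E_def Shat_z1_def Shat_n_def)

lemma Shat_z_eq:
  assumes "vector_space smul"
  shows "Shat_z smul = (0, 3, - 2)"
proof -
  interpret vector_space smul by (rule assms)
  show ?thesis by (simp add: Shat_z_def Shat_scale_def Shat_z1_def Shat_n_def)
qed

lemma four_eight_nonzero:
  assumes "(2 :: 'k::field) \<noteq> 0"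
  shows "(4 :: 'k) \<noteq> 0" "(8 :: 'k) \<noteq> 0"
proof -
  have "(4 :: 'k) = 2 ^ 2" "(8 :: 'k) = 2 ^ 3" by simp_all
  then show "(4 :: 'k) \<noteq> 0" "(8 :: 'k) \<noteq> 0"
    using assms by (metis power_not_zero)+
qed

lemma Shat_axis_mult:
  fixes smul :: "'k::field \<Rightarrow> 'e::ab_group_add \<Rightarrow> 'e"
  assumes "vector_space smul" and "symmetric_bilinear_form smul b" and "(2 :: 'k) \<noteq> 0"
  shows "Shat_mult smul b (Shat_axis smul x) (Shat_axis smul y) =
    Shat_scale smul (1 / 2) (Shat_axis smul x + Shat_axis smul y)
      + Shat_scale smul ((1 - b x y) / 4) (Shat_z smul)"
proof -
  interpret vector_space smul by (rule assms(1))
  note b = symmetric_bilinear_formD(1-4)[OF assms(2)]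
  show ?thesis
    using assms(3) four_eight_nonzero[OF assms(3)]
    by (simp add: Shat_axis_eq Shat_z_eq[OF assms(1)] Shat_mult_def Shat_scale_def b
        scale_right_distrib) (simp add: field_simps)
qed

section \<open>The images of Yabe's basis\<close>

text \<open>
  The vectors of \<open>S\<close> that correspond to \<open>a\<^sub>0, a\<^sub>1, a\<^sub>-\<^sub>1, q\<close>. The parameter \<open>\<mu>\<close> is meant to be
  \<open>b(e,f)\<close>, but the definition does not refer to \<open>b\<close>.
\<close>

fun Shat_yabe_basis ::
    "('k::field \<Rightarrow> 'e::ab_group_add \<Rightarrow> 'e) \<Rightarrow> 'k \<Rightarrow> 'e \<Rightarrow> 'e \<Rightarrow> yabe_index \<Rightarrow> 'e \<times> 'k \<times> 'k" where
  "Shat_yabe_basis smul \<mu> e f A0 = Shat_axis smul e"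
| "Shat_yabe_basis smul \<mu> e f A1 = Shat_axis smul f"
| "Shat_yabe_basis smul \<mu> e f Am1 = Shat_axis smul (smul (2 * \<mu>) e - f)"
| "Shat_yabe_basis smul \<mu> e f Q = Shat_scale smul ((1 - \<mu>) / 4) Shat_n"

lemma Shat_axis_reflection:
  fixes smul :: "'k::field \<Rightarrow> 'e::ab_group_add \<Rightarrow> 'e"
  assumes "vector_space smul" and "(2 :: 'k) \<noteq> 0"
  shows "Shat_axis smul f + Shat_axis smul (smul (2 * \<mu>) e - f)
      - Shat_scale smul (2 * \<mu>) (Shat_axis smul e) =
    Shat_scale smul (1 - \<mu>) (Shat_n - Shat_z1)"
proof -
  interpret vector_space smul by (rule assms(1))
  show ?thesis
    using assms(2)
    by (simp add: Shat_axis_eq Shat_scale_def Shat_n_def Shat_z1_def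
        scale_right_diff_distrib)
qed

text \<open>
  This is what fixes the image of \<open>q\<close>: the multiple \<open>(1 - \<mu>)/4\<close> of \<open>n\<close> turns the contribution of the
  three idempotents, a multiple of \<open>n - z\<^sub>1\<close>, into a multiple of \<open>z = 3z\<^sub>1 - 2n\<close>.
\<close>

lemma basis_extension_yabe_s:
  fixes smul :: "'k::field \<Rightarrow> 'e::ab_group_add \<Rightarrow> 'e"
  assumes "vector_space smul" and "(2 :: 'k) \<noteq> 0"
  shows "basis_extension (Shat_scale smul) (Shat_yabe_basis smul \<mu> e f)
      (yabe_s (- 1) (- 2 * \<mu> - 1)) = Shat_scale smul ((1 - \<mu>) / 4) (Shat_z smul)"
    (is "?\<psi> ?s = _")
proof -
  interpret vector_space smul by (rule assms(1))
  note vS = vector_space_Shat_scale[OF assms(1)]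
  interpret S: vector_space "Shat_scale smul" by (rule vS)
  interpret L: Vector_Spaces.linear "(*s)" "Shat_scale smul"
    "basis_extension (Shat_scale smul) (Shat_yabe_basis smul \<mu> e f)"
    by (rule linear_basis_extension[OF vS])
  have "yabe_s (- 1) (- 2 * \<mu> - 1) =
      (- 3 / 4) *s (yabe_basis A1 + yabe_basis Am1 - (2 * \<mu>) *s yabe_basis A0) + yabe_basis Q"
    by (simp add: yabe_s_def)
  then have "?\<psi> ?s =
      Shat_scale smul (- 3 / 4) (Shat_scale smul (1 - \<mu>) (Shat_n - Shat_z1))
        + Shat_scale smul ((1 - \<mu>) / 4) Shat_n"
    by (simp only: L.add L.diff L.scale basis_extension_axis[OF vS] Shat_yabe_basis.simps
        Shat_axis_reflection[OF assms])
  also have "\<dots> = Shat_scale smul ((1 - \<mu>) / 4) (Shat_z smul)"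
  proof -
    define k where "k = (1 - \<mu>) / 4"
    have "(- 3 / 4) * (1 - \<mu>) = - 3 * k"
      by (simp only: k_def times_divide_eq_left times_divide_eq_right)
    then show ?thesis
      by (simp only: S.scale_scale flip: k_def)
        (simp add: Shat_z_eq[OF assms(1)] Shat_scale_def Shat_n_def Shat_z1_def)
  qed
  finally show ?thesis .
qed

lemma Shat_yabe_basis_mult:
  fixes smul :: "'k::field \<Rightarrow> 'e::ab_group_add \<Rightarrow> 'e"
  assumes "vector_space smul" and "symmetric_bilinear_form smul b" and "(2 :: 'k) \<noteq> 0"
    and "b e e = 1" and "b f f = 1" and "b e f = \<mu>"
  shows "basis_extension (Shat_scale smul) (Shat_yabe_basis smul \<mu> e f)
      (yabe_basis_mult (- 1) (- 2 * \<mu> - 1) i j) =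
    Shat_mult smul b (Shat_yabe_basis smul \<mu> e f i) (Shat_yabe_basis smul \<mu> e f j)"
proof -
  let ?\<psi> = "basis_extension (Shat_scale smul) (Shat_yabe_basis smul \<mu> e f)"
  let ?m = "Shat_mult smul b"
  interpret vector_space smul by (rule assms(1))
  note vS = vector_space_Shat_scale[OF assms(1)]
  interpret S: vector_space "Shat_scale smul" by (rule vS)
  interpret L: Vector_Spaces.linear "(*s)" "Shat_scale smul" ?\<psi>
    by (rule linear_basis_extension[OF vS])
  note D = symmetric_bilinear_formD[OF assms(2)]
  define g where "g = smul (2 * \<mu>) e - f"
  have bdiff: "b (x - x') y = b x y - b x' y" for x x' y
    using D(1)[of "x - x'" x' y] by (simp add: algebra_simps)
  have eg: "b e g = \<mu>" "b g e = \<mu>"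
    and fg: "b f g = 2 * \<mu>\<^sup>2 - 1" "b g f = 2 * \<mu>\<^sup>2 - 1"
    using assms(4-6) D(7)[of e g] D(7)[of f g] D(7)[of e f]
    by (simp_all add: g_def bdiff D(3) power2_eq_square)
  have "b g g = b (smul (2 * \<mu>) e - f) g" by (simp only: g_def)
  also have "\<dots> = 1" by (simp only: bdiff D(3) eg fg) (simp add: power2_eq_square)
  finally have gg: "b g g = 1" .
  have idem: "?m (Shat_axis smul x) (Shat_axis smul x) = Shat_axis smul x" if "b x x = 1" for x
  proof -
    have "Shat_scale smul (1 / 2) (Shat_axis smul x + Shat_axis smul x) =
        Shat_scale smul (1 / 2 + 1 / 2) (Shat_axis smul x)"
      by (simp only: S.scale_left_distrib S.scale_right_distrib)
    also have "(1 / 2 + 1 / 2 :: 'k) = 1"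
      using assms(3) by (simp add: field_simps)
    finally show ?thesis
      by (simp add: Shat_axis_mult[OF assms(1-3)] that)
  qed
  have s: "?\<psi> (yabe_s (- 1) (- 2 * \<mu> - 1)) = Shat_scale smul ((1 - \<mu>) / 4) (Shat_z smul)"
    by (rule basis_extension_yabe_s[OF assms(1,3)])
  \<comment> \<open>The left side is \<open>(1 - b(f,g))/4\<close>; the right side is the coefficient \<open>1 - \<delta>\<close> in \<open>a\<^sub>1 a\<^sub>-\<^sub>1\<close>
    times the factor by which the image of \<open>s\<close> differs from \<open>z\<close>.\<close>
  have coeff: "(1 - (2 * \<mu>\<^sup>2 - 1)) / 4 = (1 - (- 2 * \<mu> - 1)) * ((1 - \<mu>) / 4)"
  proof -
    have "1 - (2 * \<mu>\<^sup>2 - 1) = (1 - (- 2 * \<mu> - 1)) * (1 - \<mu>)"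
      by (simp add: power2_eq_square algebra_simps)
    then show ?thesis by (simp only: times_divide_eq_right)
  qed
  have ann: "?m u (Shat_scale smul c Shat_n) = 0" "?m (Shat_scale smul c Shat_n) u = 0" for u c
    by (cases u; simp add: Shat_mult_def Shat_scale_def Shat_n_def D(5,6) zero_prod_def)+
  have q: "yabe_q_eigenvalue (- 1) (- 2 * \<mu> - 1) = 0"
    by (simp add: yabe_q_eigenvalue_def)
  note axis = Shat_axis_mult[OF assms(1-3)]
  have fe: "b f e = \<mu>" using assms(6) D(7)[of e f] by simp
  have "?m (Shat_axis smul e) (Shat_axis smul e) = Shat_axis smul e"
    "?m (Shat_axis smul f) (Shat_axis smul f) = Shat_axis smul f"
    "?m (Shat_axis smul g) (Shat_axis smul g) = Shat_axis smul g"
    by (rule idem, fact)+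
  note simps = yabe_basis_mult.simps Shat_yabe_basis.simps g_def[symmetric]
    this axis[of e f] axis[of f e] axis[of e g] axis[of g e] axis[of f g] axis[of g f]
    eg fg assms(6) fe s coeff ann q L.add L.scale basis_extension_axis[OF vS]
    S.scale_scale mult_zero_left S.scale_zero_left
  show ?thesis
    by (cases i; cases j) (simp_all only: simps add.commute)
qed

section \<open>Bijectivity\<close>

lemma spanning_pair_coefficients_eq_0:
  fixes smul :: "'k::field \<Rightarrow> 'e::ab_group_add \<Rightarrow> 'e"
  assumes "vector_space smul" and "vector_space.dim smul (UNIV :: 'e set) = 2"
    and "module.span smul {e, f} = UNIV" and "smul c e + smul d f = 0"
  shows "c = 0 \<and> d = 0"
proof -
  interpret vector_space smul by (rule assms(1))
  \<comment> \<open>A basis contained in \<open>{e, f}\<close> has two elements, so it is all of \<open>{e, f}\<close>.\<close>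
  obtain B where B: "B \<subseteq> {e, f}" "independent B" "card B = dim {e, f}"
    by (rule basis_exists[of "{e, f}"])
  have card: "card B = 2"
    unfolding B(3) using dim_span[of "{e, f}"] unfolding assms(2,3) by (rule sym)
  have "card {e, f} \<le> card B"
    unfolding card by (simp add: card_insert_if)
  then have Bef: "B = {e, f}"
    using card_seteq[of "{e, f}" B] B(1) by blast
  have ne: "e \<noteq> f"
  proof
    assume "e = f"
    then have "card {e, f} = 1" by simp
    then show False using card unfolding Bef by linarith
  qed
  let ?u = "\<lambda>x. if x = e then c else d"
  have sum: "(\<Sum>x\<in>{e, f}. smul (?u x) x) = 0"
    using ne assms(4) by simp
  have "?u x = 0" if "x \<in> {e, f}" for x
    by (rule independentD[OF B(2) _ _ sum that]) (simp_all add: Bef)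
  from this[of e] this[of f] show ?thesis
    using ne by simp
qed

lemma basis_extension_Shat_yabe_basis:
  fixes smul :: "'k::field \<Rightarrow> 'e::ab_group_add \<Rightarrow> 'e"
  assumes "vector_space smul"
  shows "basis_extension (Shat_scale smul) (Shat_yabe_basis smul \<mu> e f) u =
    (smul ((u $ A0 + 2 * \<mu> * u $ Am1) / 2) e + smul ((u $ A1 - u $ Am1) / 2) f,
     - ((u $ A0 + u $ A1 + u $ Am1) / 2),
     (u $ A0 + u $ A1 + u $ Am1) / 2 + (1 - \<mu>) / 4 * u $ Q)"
proof -
  interpret vector_space smul by (rule assms)
  show ?thesis
    by (simp add: basis_extension_def UNIV_yabe_index Shat_axis_eq Shat_scale_def
        Shat_n_def add_divide_distrib diff_divide_distrib algebra_simps)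
qed

lemma bij_basis_extension_Shat_yabe_basis:
  fixes smul :: "'k::field \<Rightarrow> 'e::ab_group_add \<Rightarrow> 'e"
  assumes "vector_space smul" and "vector_space.dim smul (UNIV :: 'e set) = 2"
    and "module.span smul {e, f} = UNIV" and "(2 :: 'k) \<noteq> 0" and "\<mu> \<noteq> 1"
  shows "bij (basis_extension (Shat_scale smul) (Shat_yabe_basis smul \<mu> e f))" (is "bij ?\<psi>")
proof (rule bijI)
  interpret vector_space smul by (rule assms(1))
  interpret L: Vector_Spaces.linear "(*s)" "Shat_scale smul" ?\<psi>
    by (rule linear_basis_extension[OF vector_space_Shat_scale[OF assms(1)]])
  note eq = basis_extension_Shat_yabe_basis[OF assms(1)]
  note four = four_eight_nonzero(1)[OF assms(4)]
  have \<mu>: "1 - \<mu> \<noteq> 0" using assms(5) by simp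
  show "inj ?\<psi>"
    unfolding L.inj_iff_eq_0
  proof (intro allI impI)
    fix u :: "'k ^ yabe_index"
    assume zero: "?\<psi> u = 0"
    have "smul ((u $ A0 + 2 * \<mu> * u $ Am1) / 2) e + smul ((u $ A1 - u $ Am1) / 2) f = 0"
      using zero unfolding eq zero_prod_def by simp
    from spanning_pair_coefficients_eq_0[OF assms(1-3) this]
    have u01: "u $ A0 = - 2 * \<mu> * u $ Am1" "u $ A1 = u $ Am1"
      using assms(4) by (simp_all add: eq_neg_iff_add_eq_0)
    have sum: "u $ A0 + u $ A1 + u $ Am1 = 0"
      using zero assms(4) unfolding eq zero_prod_def by simp
    then have "2 * (1 - \<mu>) * u $ Am1 = 0"
      unfolding u01 by (simp add: algebra_simps)
    then have um: "u $ Am1 = 0" using assms(4) \<mu> by simp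
    have "(1 - \<mu>) / 4 * u $ Q = 0"
      using zero sum unfolding eq zero_prod_def by simp
    then have "u $ Q = 0" using four \<mu> by simp
    with um u01 have "u $ i = 0" for i by (cases i) simp_all
    then show "u = 0" by (simp add: vec_eq_iff)
  qed
  show "surj ?\<psi>"
  proof (unfold surj_def, rule allI)
    fix y :: "'e \<times> 'k \<times> 'k"
    obtain x s t where y: "y = (x, s, t)" by (cases y) auto
    have "x \<in> span {e, f}" using assms(3) by simp
    then obtain c d where x: "x = smul c e + smul d f"
      by (auto simp: span_insert span_singleton) (metis add.commute diff_add_cancel)
    \<comment> \<open>The coordinate at \<open>a\<^sub>-\<^sub>1\<close> is determined by the coefficient of \<open>z\<^sub>1\<close> once the other two
      idempotents are adjusted to produce \<open>x\<close>.\<close>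
    define w where "w = - (s + c + d) / (1 - \<mu>)"
    have w: "(1 - \<mu>) * w = - (s + c + d)" using \<mu> by (simp add: w_def)
    define u :: "'k ^ yabe_index" where "u = (\<chi> i. case i of
        A0 \<Rightarrow> 2 * (c - \<mu> * w) | A1 \<Rightarrow> 2 * d + w | Am1 \<Rightarrow> w | Q \<Rightarrow> 4 * (s + t) / (1 - \<mu>))"
    have "u $ A0 + u $ A1 + u $ Am1 = 2 * (c + d + (1 - \<mu>) * w)"
      by (simp add: u_def algebra_simps)
    then have sum: "(u $ A0 + u $ A1 + u $ Am1) / 2 = - s"
      using assms(4) by (simp add: w)
    have "(u $ A0 + 2 * \<mu> * u $ Am1) / 2 = c" "(u $ A1 - u $ Am1) / 2 = d"
      using assms(4) by (simp_all add: u_def algebra_simps)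
    moreover have "(1 - \<mu>) / 4 * u $ Q = s + t"
    proof -
      have cancel: "r / 4 * (4 * v / r) = v" if "r \<noteq> 0" for r v :: 'k
        using four that by simp
      have "u $ Q = 4 * (s + t) / (1 - \<mu>)"
        by (simp add: u_def)
      then show ?thesis
        using cancel[OF \<mu>, of "s + t"] by argo
    qed
    ultimately have "?\<psi> u = y"
      by (simp only: eq sum x y) simp
    then show "\<exists>u. y = ?\<psi> u" by blast
  qed
qed

theorem theorem6p8:
  fixes smul :: "'k::field \<Rightarrow> 'e::ab_group_add \<Rightarrow> 'e"
    and b :: "'e \<Rightarrow> 'e \<Rightarrow> 'k"
    and e f :: 'e
    and \<mu> :: 'k
  assumes "CHAR('k) \<noteq> 2" and "CHAR('k) \<noteq> 3"
    and "vector_space smul"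
    and "vector_space.dim smul (UNIV :: 'e set) = 2"
    and "module.span smul {e, f} = (UNIV :: 'e set)"
    and "symmetric_bilinear_form smul b"
    and "b e e = 1" and "b f f = 1" and "b e f = \<mu>"
    and "\<mu> \<noteq> 1"
  shows "algebra_isomorphic (Shat_scale smul) (Shat_mult smul b)
           ((*s) :: 'k \<Rightarrow> 'k ^ yabe_index \<Rightarrow> 'k ^ yabe_index)
           (yabe_III_half_mult (- 1) (- 2 * \<mu> - 1))"
proof (rule algebra_isomorphic_sym)
  have two: "(2 :: 'k) \<noteq> 0"
  proof
    assume "(2 :: 'k) = 0"
    then have "of_nat 2 = (0 :: 'k)" by simp
    then have "CHAR('k) dvd 2" by (simp only: of_nat_eq_0_iff_char_dvd)
    then have "CHAR('k) = 1 \<or> CHAR('k) = 2"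
      using two_is_prime_nat prime_nat_iff by blast
    then show False using assms(1) CHAR_not_1'[where 'a = 'k] by simp
  qed
  let ?\<psi> = "basis_extension (Shat_scale smul) (Shat_yabe_basis smul \<mu> e f)"
  note vS = vector_space_Shat_scale[OF assms(3)]
  have "?\<psi> (yabe_III_half_mult (- 1) (- 2 * \<mu> - 1) u v) = Shat_mult smul b (?\<psi> u) (?\<psi> v)" for u v
    by (rule basis_extension_yabe_mult[OF bilinear_Shat_mult[OF assms(3,6)] vS])
      (rule Shat_yabe_basis_mult[OF assms(3,6) two assms(7-9)])
  then show "algebra_isomorphic ((*s) :: 'k \<Rightarrow> 'k ^ yabe_index \<Rightarrow> 'k ^ yabe_index)
      (yabe_III_half_mult (- 1) (- 2 * \<mu> - 1)) (Shat_scale smul) (Shat_mult smul b)"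
    unfolding algebra_isomorphic_def
    using linear_basis_extension[OF vS]
      bij_basis_extension_Shat_yabe_basis[OF assms(3-5) two assms(10)]
    by blast
qed

end
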